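(* ($N=3$.) Let $n\ge1$. For every complex $3\times n$ matrix $(\xi^A_I)$ consider the infinitesimal transformation (real-linear vector field) on $\mathbb C^3\times\mathbb C^n\ni(Z^A,Z_I)$ given by $$\delta Z^A=\xi^A_I\,\bar Z^I,\qquad \delta Z_I=\xi^A_I\,\bar Z_A .$$ Then $$S=Z^A\bar Z_A-Z_I\bar Z^I$$ is invariant: $\delta S=0$ for all $\xi$. Thus $S$ is a U-duality ($SU(3,n)$) invariant, i.e. it is independent of the moduli.
   Context: In $D=4$, $N=3$ supergravity with $n$ vector multiplets, the scalar manifold is $G/H=SU(3,n)/(SU(3)\times SU(n)\times U(1))$, the central charges are $Z_{AB}=\epsilon_{ABC}Z^C$ ($A,B,C=1,2,3$), and the matter charges are $Z_I$ ($I=1,\dots,n$). $\bar Z_A=(Z^A)^*$ and $\bar Z^I=(Z_I)^*$; repeated indices are summed; $\delta$ acts as a derivation, with the variation of a complex conjugate being the conjugate of the variation. The displayed $\delta$ are the infinitesimal transformations by the non-compact generators (those in the coset directions) of $SU(3,n)$; the charges' covariant derivatives on $G/H$ have the same form with $\xi$ replaced by the vielbein, so moduli-independence of an $H$-invariant function of the charges means $\delta S=0$ for all $\xi$. *)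

theory Defs
  imports "HOL-Analysis.Analysis"
begin

text \<open>
  A charge configuration is a pair \<open>(Z, W)\<close> with \<open>Z $ A\<close> the central charge \<open>Z\<^sup>A\<close>
  (so that \<open>Z\<^sub>A\<^sub>B = \<epsilon>\<^sub>A\<^sub>B\<^sub>C Z\<^sup>C\<close>) and \<open>W $ I\<close> the matter charge \<open>Z\<^sub>I\<close>. The number of vector
  multiplets is \<open>n = CARD('n) \<ge> 1\<close>. Barred charges are the complex conjugates \<open>cnj\<close>.
\<close>

type_synonym 'n charges = "(complex ^ 3) \<times> (complex ^ 'n)"

text \<open>The vector field on charge space attached to \<open>\<xi> $ A $ I = \<xi>\<^sup>A\<^sub>I\<close>; it is only real-linear.\<close>

definition delta :: "complex ^ 'n ^ 3 \<Rightarrow> 'n::finite charges \<Rightarrow> 'n charges" where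
  "delta \<xi> p =
     ((\<chi> A. \<Sum>I\<in>UNIV. \<xi> $ A $ I * cnj (snd p $ I)),
      (\<chi> I. \<Sum>A\<in>UNIV. \<xi> $ A $ I * cnj (fst p $ A)))"

text \<open>
  \<open>\<delta>F\<close> is the derivative of \<open>F\<close> along the vector field. The derivative is the real Frechet
  derivative, so \<open>\<delta>\<close> is a derivation and commutes with complex conjugation. Since
  \<^const>\<open>frechet_derivative\<close> is unspecified where \<open>F\<close> is not differentiable, invariance includes
  differentiability.
\<close>

definition variation :: "complex ^ 'n ^ 3 \<Rightarrow> ('n::finite charges \<Rightarrow> complex) \<Rightarrow> 'n charges \<Rightarrow> complex" where
  "variation \<xi> F p = frechet_derivative F (at p) (delta \<xi> p)"

definition infinitesimally_invariant :: "('n::finite charges \<Rightarrow> complex) \<Rightarrow> bool" where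
  "infinitesimally_invariant F \<longleftrightarrow>
     (\<forall>p. F differentiable (at p)) \<and> (\<forall>\<xi> p. variation \<xi> F p = 0)"

definition S_inv :: "'n::finite charges \<Rightarrow> complex" where
  "S_inv p = (\<Sum>A\<in>UNIV. fst p $ A * cnj (fst p $ A)) - (\<Sum>I\<in>UNIV. snd p $ I * cnj (snd p $ I))"

definition conj_transpose :: "complex ^ 'n ^ 'm \<Rightarrow> complex ^ 'm ^ 'n" where
  "conj_transpose M = (\<chi> i j. cnj (M $ j $ i))"

definition eta :: "complex ^ (3 + 'n::finite) ^ (3 + 'n)" where
  "eta = (\<chi> i j. if i = j then (case i of Inl A \<Rightarrow> 1 | Inr I \<Rightarrow> - 1) else 0)"

definition SU3n :: "(complex ^ (3 + 'n::finite) ^ (3 + 'n)) set" where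
  "SU3n = {g. conj_transpose g ** eta ** g = eta \<and> det g = 1}"

text \<open>
  The block-diagonal elements of \<open>SU(3,n)\<close>, i.e. pairs of unitary blocks with total determinant
  1. This is the image of \<open>SU(3) \<times> SU(n) \<times> U(1)\<close> in \<open>SU(3,n)\<close>.
\<close>

definition Hsub :: "(complex ^ (3 + 'n::finite) ^ (3 + 'n)) set" where
  "Hsub = {h \<in> SU3n. \<forall>A I. h $ Inl A $ Inr I = 0 \<and> h $ Inr I $ Inl A = 0}"

text \<open>
  The vector \<open>(Z\<^sup>A, cnj Z\<^sub>I)\<close> is the fundamental representation of \<open>SU(3,n)\<close>: it is the
  conjugate of the matter charges, not the charges themselves, on which the group is complex-linear.
\<close>

definition fund_vec :: "'n::finite charges \<Rightarrow> complex ^ (3 + 'n)" where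
  "fund_vec p = (\<chi> i. case i of Inl A \<Rightarrow> fst p $ A | Inr I \<Rightarrow> cnj (snd p $ I))"

definition of_fund_vec :: "complex ^ (3 + 'n) \<Rightarrow> 'n::finite charges" where
  "of_fund_vec v = ((\<chi> A. v $ Inl A), (\<chi> I. cnj (v $ Inr I)))"

definition act :: "complex ^ (3 + 'n) ^ (3 + 'n) \<Rightarrow> 'n::finite charges \<Rightarrow> 'n charges" where
  "act M p = of_fund_vec (M *v fund_vec p)"

definition U_duality_invariant :: "('n::finite charges \<Rightarrow> complex) \<Rightarrow> bool" where
  "U_duality_invariant F \<longleftrightarrow> (\<forall>g\<in>SU3n. \<forall>p. F (act g p) = F p)"

text \<open>
  The charges' covariant derivatives on \<open>G/H\<close> are \<^const>\<open>delta\<close> with \<open>\<xi>\<close> replaced by the vielbein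
  (which spans all \<open>\<xi>\<close>), so an \<open>H\<close>-invariant function of the charges is moduli-independent when all
  its variations vanish.
\<close>

definition moduli_independent :: "('n::finite charges \<Rightarrow> complex) \<Rightarrow> bool" where
  "moduli_independent F \<longleftrightarrow>
     (\<forall>h\<in>Hsub. \<forall>p. F (act h p) = F p) \<and> infinitesimally_invariant F"

text \<open>
  The next lemmas confirm that \<^const>\<open>delta\<close> is the action of the non-compact (off-diagonal)
  generators of \<open>SU(3,n)\<close>: these are exactly the matrices \<open>coset_gen \<xi>\<close>.
\<close>

definition coset_gen :: "complex ^ 'n ^ 3 \<Rightarrow> complex ^ (3 + 'n::finite) ^ (3 + 'n)" where
  "coset_gen \<xi> = (\<chi> i j. case (i, j) of
       (Inl A, Inr I) \<Rightarrow> \<xi> $ A $ I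
     | (Inr I, Inl A) \<Rightarrow> cnj (\<xi> $ A $ I)
     | _ \<Rightarrow> 0)"

lemma sum_UNIV_Plus:
  fixes f :: "'a::finite + 'b::finite \<Rightarrow> complex"
  shows "sum f UNIV = (\<Sum>a\<in>UNIV. f (Inl a)) + (\<Sum>b\<in>UNIV. f (Inr b))"
  by (subst UNIV_Plus_UNIV [symmetric], subst sum.Plus) auto

lemma act_coset_gen: "act (coset_gen \<xi>) p = delta \<xi> p"
  by (simp add: act_def of_fund_vec_def delta_def fund_vec_def coset_gen_def
      matrix_vector_mult_def sum_UNIV_Plus vec_eq_iff)

lemma matrix_mult_eta: "(M ** eta) $ i $ j = M $ i $ j * (case j of Inl A \<Rightarrow> 1 | Inr I \<Rightarrow> - 1)"
  by (simp add: matrix_matrix_mult_def eta_def if_distrib cong: if_cong)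

lemma eta_matrix_mult: "(eta ** M) $ i $ j = (case i of Inl A \<Rightarrow> 1 | Inr I \<Rightarrow> - 1) * M $ i $ j"
  by (simp add: matrix_matrix_mult_def eta_def if_distrib [where f = "\<lambda>x. x * _"] cong: if_cong)

lemma off_diagonal_su3n_iff:
  fixes X :: "complex ^ (3 + 'n::finite) ^ (3 + 'n)"
  shows "(conj_transpose X ** eta + eta ** X = 0 \<and> trace X = 0 \<and>
          (\<forall>A B. X $ Inl A $ Inl B = 0) \<and> (\<forall>I J. X $ Inr I $ Inr J = 0))
         \<longleftrightarrow> (\<exists>\<xi>. X = coset_gen \<xi>)"  (is "?L \<longleftrightarrow> ?R")
proof
  assume L: ?L
  have "X $ Inr I $ Inl A = cnj (X $ Inl A $ Inr I)" for A I
  proof -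
    have "(conj_transpose X ** eta + eta ** X) $ Inr I $ Inl A = 0"
      using L by simp
    then show ?thesis
      by (simp add: matrix_mult_eta eta_matrix_mult conj_transpose_def)
  qed
  then have "X = coset_gen (\<chi> A I. X $ Inl A $ Inr I)"
    using L by (auto simp: vec_eq_iff coset_gen_def split: sum.split)
  then show ?R ..
next
  assume ?R
  then obtain \<xi> where "X = coset_gen \<xi>" ..
  then show ?L
    by (auto simp: vec_eq_iff coset_gen_def matrix_mult_eta eta_matrix_mult conj_transpose_def
        trace_def sum_UNIV_Plus split: sum.split)
qed

end

theory Submission
  imports Defs
begin

text \<open>
  Differentiating \<open>S\<close> along \<open>\<delta>\<close> gives
  \<open>2 Re (\<xi>\<^sup>A\<^sub>I cnj Z\<^sub>A cnj Z\<^sub>I)\<close> from the central and from the matter charges alike, so the two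
  contributions cancel in the difference. Globally, \<open>S\<close> is the Hermitian form \<open>v\<^sup>\<dagger> \<eta> v\<close>
  of the vector \<open>v\<close> in the fundamental representation, and \<open>g\<^sup>\<dagger> \<eta> g = \<eta>\<close>.
\<close>

lemma fund_vec_act: "fund_vec (act M p) = M *v fund_vec p"
  by (simp add: act_def fund_vec_def of_fund_vec_def vec_eq_iff split: sum.split)

text \<open>\<open>conj_transpose M\<close> is the adjoint of \<open>M\<close> for the standard
  Hermitian product.\<close>

lemma sum_cnj_matrix_vector_mult:
  "(\<Sum>i\<in>UNIV. cnj ((M *v v) $ i) * w $ i) = (\<Sum>j\<in>UNIV. cnj (v $ j) * (conj_transpose M *v w) $ j)"
  by (simp add: matrix_vector_mult_def conj_transpose_def sum_distrib_left sum_distrib_right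
      mult_ac) (rule sum.swap)

lemma eta_mult_vec: "(eta *v v) $ i = (case i of Inl A \<Rightarrow> 1 | Inr I \<Rightarrow> - 1) * v $ i"
  by (simp add: matrix_vector_mult_def eta_def if_distrib [where f = "\<lambda>x. x * _"] cong: if_cong)

text \<open>Conjugating the matter charges in \<open>fund_vec\<close> leaves each squared modulus
  unchanged.\<close>

lemma S_inv_eq_hermitian_form:
  "S_inv p = (\<Sum>i\<in>UNIV. cnj (fund_vec p $ i) * (eta *v fund_vec p) $ i)"
  by (simp add: S_inv_def eta_mult_vec fund_vec_def sum_UNIV_Plus sum_negf mult.commute)

lemma S_inv_act:
  assumes "conj_transpose g ** eta ** g = eta"
  shows "S_inv (act g p) = S_inv p"
proof -
  have "conj_transpose g *v (eta *v (g *v v)) = eta *v v" for v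
    using assms by (simp add: matrix_vector_mul_assoc matrix_mul_assoc)
  then show ?thesis
    by (simp add: S_inv_eq_hermitian_form fund_vec_act sum_cnj_matrix_vector_mult)
qed

text \<open>Conjugation is real-linear, so the product rule applies to each squared modulus.\<close>

lemma S_inv_has_derivative:
  "(S_inv has_derivative
     (\<lambda>q. (\<Sum>A\<in>UNIV. fst p $ A * cnj (fst q $ A) + fst q $ A * cnj (fst p $ A)) -
          (\<Sum>I\<in>UNIV. snd p $ I * cnj (snd q $ I) + snd q $ I * cnj (snd p $ I)))) (at p)"
proof -
  have Z: "((\<lambda>p. fst p $ A) has_derivative (\<lambda>q. fst q $ A)) (at p)" for A
    by (intro bounded_linear_imp_has_derivative
        bounded_linear_compose [OF bounded_linear_vec_nth bounded_linear_fst])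
  have W: "((\<lambda>p. snd p $ I) has_derivative (\<lambda>q. snd q $ I)) (at p)" for I
    by (intro bounded_linear_imp_has_derivative
        bounded_linear_compose [OF bounded_linear_vec_nth bounded_linear_snd])
  show ?thesis
    unfolding S_inv_def [abs_def]
    by (intro has_derivative_diff has_derivative_sum has_derivative_mult has_derivative_cnj Z W)
qed

lemma variation_S_inv: "variation \<xi> S_inv p = 0"
proof -
  \<comment> \<open>Fixing the index types fixes the direction of the exchange: all double sums end
    with \<open>I\<close> outermost and cancel.\<close>
  have "(\<Sum>A\<in>UNIV. \<Sum>I\<in>UNIV. f A I) = (\<Sum>I\<in>UNIV. \<Sum>A\<in>UNIV. f A I)" for f :: "3 \<Rightarrow> 'a \<Rightarrow> complex"
    by (rule sum.swap)
  then show ?thesis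
    unfolding variation_def frechet_derivative_at [OF S_inv_has_derivative, symmetric]
    by (simp add: delta_def sum_distrib_left sum_distrib_right sum.distrib mult_ac)
qed

theorem mainTheorem3:
  shows "(\<forall>p :: 'n::finite charges. S_inv differentiable (at p)) \<and>
         (\<forall>(\<xi> :: complex ^ 'n ^ 3) p. variation \<xi> S_inv p = 0) \<and>
         U_duality_invariant (S_inv :: 'n charges \<Rightarrow> complex) \<and>
         moduli_independent (S_inv :: 'n charges \<Rightarrow> complex)"
proof -
  have "S_inv differentiable (at p)" for p :: "'n charges"
    using S_inv_has_derivative by (rule differentiableI)
  \<comment> \<open>Invariance under \<open>Hsub\<close> is inherited from \<open>SU3n\<close>,
    which contains it.\<close>
  then show ?thesis
    by (auto simp: variation_S_inv U_duality_invariant_def moduli_independent_def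
        infinitesimally_invariant_def Hsub_def SU3n_def S_inv_act)
qed

end
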